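(* Let $n\ge1$, let $\alpha=(\alpha_1,\ldots,\alpha_n)\in\mathbb{Z}^n$, let $X=\mathbb{C}^n$ with the standard coordinate action of $T^n=(\mathbb{C}^\times)^n$ linearized to the trivial line bundle $\mathcal{L}$ by $\alpha$, and let $G\subseteq T^n$ be an algebraic subgroup acting by restriction. Let $\Delta$ be the polyhedron associated to $(G,\alpha)$ and, for $i\in\{1,\ldots,n\}$, let $F_i=\{p\in\Delta\mid p\cdot a_i=\alpha_i\}$. For any point $x=(x_1,\ldots,x_n)\in X$, let $A=\{i\mid x_i=0\}$. Then $x$ is semistable (for the linearized action of $G$) if and only if $\bigcap_{i\in A}F_i\ne\emptyset$, where the intersection is taken inside $\Delta$ (so that it equals $\Delta$ if $A=\emptyset$).
   Context: Linearized action: let $R=\mathbb{C}[x_1,\ldots,x_n,t]$ be graded by $\deg x_i=0$, $\deg t=1$, so that $X=\operatorname{Proj}R=\mathbb{C}^n$ and $\mathcal{L}=\mathcal{O}_X(1)$ is the trivial line bundle. The torus $T^n$ acts on $R$ by $\lambda\cdot x_i=\lambda_ix_i$ and $\lambda\cdot t=\lambda_1^{\alpha_1}\cdots\lambda_n^{\alpha_n}\,t$. On the total space $\mathbb{C}^n\times\mathbb{C}$ of the dual line bundle $\mathcal{L}^*$ this gives the action $$\lambda\cdot(x,\ell)=\big((\lambda_1x_1,\ldots,\lambda_nx_n),\ \lambda_1^{\alpha_1}\cdots\lambda_n^{\alpha_n}\,\ell\big).$$ Semistability: a point $x\in X$ is called semistable if, for all nonzero $\ell\in\mathcal{L}^*_x=\mathbb{C}$,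 the closure of the $G$-orbit $G\cdot(x,\ell)$ in the total space $\mathbb{C}^n\times\mathbb{C}$ of $\mathcal{L}^*$ is disjoint from the zero section $\mathbb{C}^n\times\{0\}$. Polyhedron: let $T=T^n/G$, and let $\mathfrak{g}$, $\mathfrak{t}^n$, $\mathfrak{t}$ be the complex Lie algebras of $G$, $T^n$, $T$, so that there is an exact sequence $0\to\mathfrak{g}\to\mathfrak{t}^n\to\mathfrak{t}\to0$. Let $e_1,\ldots,e_n$ be the coordinate vectors of $\mathfrak{t}^n=\mathbb{C}^n$ and let $a_i\in\mathfrak{t}$ be the image of $e_i$. The vector space $\mathfrak{t}$ carries the integer lattice $\mathfrak{t}_{\mathbb{Z}}=\ker(\exp:\mathfrak{t}\to T)$, where $\exp$ is normalized so that the corresponding lattice of $\mathfrak{t}^n$ is $\mathbb{Z}^n=\mathbb{Z}\{e_1,\ldots,e_n\}$; thus $a_i\in\mathfrak{t}_{\mathbb{Z}}$. The dual space $\mathfrak{t}^*$ has the dual lattice $\mathfrak{t}^*_{\mathbb{Z}}$ and real part $\mathfrak{t}^*_{\mathbb{R}}=\mathfrak{t}^*_{\mathbb{Z}}\otimes_{\mathbb{Z}}\mathbb{R}$. Equivalently, $\mathfrak{t}^*_{\mathbb{Z}}$ is the character lattice of $T$, and for a character $p$ of $T$ the integer $p\cdot a_i$ is the exponent of $\lambda_i$ in the character of $T^n$ obtained by pulling $p$ back along $T^n\to T$. The polyhedron associated to $(G,\alpha)$ is $$\Delta=\{p\in\mathfrak{t}^*_{\mathbb{R}}\mid p\cdot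 a_i\ge\alpha_i\text{ for all }i=1,\ldots,n\}.$$ *)

theory Defs
  imports "HOL-Analysis.Analysis" "HOL-Algebra.Coset"
begin

text \<open>The rank of the torus is the cardinality of the (nonempty, finite) index type \<open>'n\<close>.
  The product and \<open>1\<close> on \<open>complex ^ 'n\<close> are the componentwise ones.\<close>

definition torus :: "(complex ^ 'n) monoid" where
  "torus = \<lparr>carrier = {z. \<forall>i. z $ i \<noteq> 0}, mult = (*), one = 1\<rparr>"

definition laurent_monom :: "int ^ 'n \<Rightarrow> complex ^ 'n \<Rightarrow> complex" where
  "laurent_monom m z = (\<Prod>i\<in>UNIV. (z $ i) powi (m $ i))"

text \<open>The coordinate ring of the torus: Laurent polynomials, as functions.\<close>

definition regular_funs :: "(complex ^ 'n \<Rightarrow> complex) set" where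
  "regular_funs = {f. \<exists>M c. finite M \<and> f = (\<lambda>z. \<Sum>m\<in>M. c m * laurent_monom m z)}"

definition algebraic_subgroup :: "(complex ^ 'n) set \<Rightarrow> bool" where
  "algebraic_subgroup G \<longleftrightarrow> subgroup G torus \<and>
     (\<exists>S \<subseteq> regular_funs. G = {z \<in> carrier torus. \<forall>f\<in>S. f z = 0})"


subsection \<open>Linearized action and semistability\<close>

text \<open>The action on the total space \<open>\<complex>\<^sup>n \<times> \<complex>\<close> of the dual of the trivial line bundle.\<close>

definition lin_act ::
  "int ^ 'n \<Rightarrow> complex ^ 'n \<Rightarrow> (complex ^ 'n) \<times> complex \<Rightarrow> (complex ^ 'n) \<times> complex" where
  "lin_act \<alpha> z = (\<lambda>(x, l). (z * x, laurent_monom \<alpha> z * l))"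

definition semistable :: "(complex ^ 'n) set \<Rightarrow> int ^ 'n \<Rightarrow> complex ^ 'n \<Rightarrow> bool" where
  "semistable G \<alpha> x \<longleftrightarrow>
     (\<forall>l. l \<noteq> 0 \<longrightarrow> closure ((\<lambda>z. lin_act \<alpha> z (x, l)) ` G) \<inter> (UNIV \<times> {0}) = {})"


subsection \<open>Lie algebras, lattices and the polyhedron\<close>

text \<open>The exponential map of the torus, normalized so that its kernel is \<open>\<int>\<^sup>n\<close>.\<close>

definition torus_exp :: "complex ^ 'n \<Rightarrow> complex ^ 'n" where
  "torus_exp \<xi> = (\<chi> i. exp (2 * of_real pi * \<i> * \<xi> $ i))"

definition lie_alg :: "(complex ^ 'n) set \<Rightarrow> (complex ^ 'n) set" where
  "lie_alg G = {\<xi>. \<forall>s. torus_exp (s *s \<xi>) \<in> G}"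

text \<open>The Lie algebra of the quotient torus \<open>torus Mod G\<close> is the space of cosets of
  \<open>lie_alg G\<close> in \<open>\<complex>\<^sup>n\<close>; \<open>quot_proj G\<close> is the projection onto it.\<close>

definition quot_proj :: "(complex ^ 'n) set \<Rightarrow> complex ^ 'n \<Rightarrow> (complex ^ 'n) set" where
  "quot_proj G \<xi> = (+) \<xi> ` lie_alg G"

definition quot_lie :: "(complex ^ 'n) set \<Rightarrow> (complex ^ 'n) set set" where
  "quot_lie G = range (quot_proj G)"

definition coord_image :: "(complex ^ 'n) set \<Rightarrow> 'n \<Rightarrow> (complex ^ 'n) set" where
  "coord_image G i = quot_proj G (axis i 1)"

text \<open>The exponential map into \<open>torus Mod G\<close> induced by \<open>torus_exp\<close>. All representatives
  of \<open>v\<close> yield the same coset of \<open>G\<close>, so the union is that coset.\<close>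

definition quot_exp :: "(complex ^ 'n) set \<Rightarrow> (complex ^ 'n) set \<Rightarrow> (complex ^ 'n) set" where
  "quot_exp G v = (\<Union>\<xi>\<in>v. G #>\<^bsub>torus\<^esub> torus_exp \<xi>)"

definition quot_lattice :: "(complex ^ 'n) set \<Rightarrow> (complex ^ 'n) set set" where
  "quot_lattice G = {v \<in> quot_lie G. quot_exp G v = \<one>\<^bsub>torus Mod G\<^esub>}"

text \<open>Linear functionals on \<open>quot_lie G\<close>, represented by functions that are \<open>0\<close> off
  \<open>quot_lie G\<close>. As the vector space structure of the quotient comes from representatives,
  linearity means linearity after composition with the projection.\<close>

definition dual_space :: "(complex ^ 'n) set \<Rightarrow> ((complex ^ 'n) set \<Rightarrow> complex) set" where
  "dual_space G = {p. Vector_Spaces.linear (*s) (*) (\<lambda>\<xi>. p (quot_proj G \<xi>)) \<and>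
                      (\<forall>v. v \<notin> quot_lie G \<longrightarrow> p v = 0)}"

definition dual_lattice :: "(complex ^ 'n) set \<Rightarrow> ((complex ^ 'n) set \<Rightarrow> complex) set" where
  "dual_lattice G = {p \<in> dual_space G. \<forall>v\<in>quot_lattice G. p v \<in> \<int>}"

text \<open>The real part of the dual space: the real span of the dual lattice.\<close>

definition dual_real :: "(complex ^ 'n) set \<Rightarrow> ((complex ^ 'n) set \<Rightarrow> complex) set" where
  "dual_real G = {p. \<exists>Q r. finite Q \<and> Q \<subseteq> dual_lattice G \<and>
                           p = (\<lambda>v. \<Sum>q\<in>Q. complex_of_real (r q) * q v)}"

text \<open>For \<open>p\<close> in the real part, \<open>p (coord_image G i)\<close> is a real number, since
  \<open>coord_image G i\<close> lies in the lattice; \<open>Re\<close> only changes its type.\<close>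

definition assoc_polyhedron :: "(complex ^ 'n) set \<Rightarrow> int ^ 'n \<Rightarrow> ((complex ^ 'n) set \<Rightarrow> complex) set" where
  "assoc_polyhedron G \<alpha> = {p \<in> dual_real G. \<forall>i. Re (p (coord_image G i)) \<ge> of_int (\<alpha> $ i)}"

definition poly_face ::
  "(complex ^ 'n) set \<Rightarrow> int ^ 'n \<Rightarrow> 'n \<Rightarrow> ((complex ^ 'n) set \<Rightarrow> complex) set" where
  "poly_face G \<alpha> i = {p \<in> assoc_polyhedron G \<alpha>. Re (p (coord_image G i)) = of_int (\<alpha> $ i)}"

end

theory Submission
  imports Defs
begin

text \<open>Let \<open>V \<subseteq> \<real>\<^sup>n\<close> be the span of the exponents of the characters of the torus that are trivial
  on \<open>G\<close>. Evaluation at the \<open>a\<^sub>i\<close> identifies the real dual of the Lie algebra of the quotient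
  with \<open>V\<close>, so the claim is that \<open>x\<close> is semistable iff some \<open>v \<in> V\<close> satisfies
  \<open>v\<^sub>i \<ge> \<alpha>\<^sub>i\<close>, with equality where \<open>x\<^sub>i = 0\<close>. Such a \<open>v\<close> gives an invariant
  function on the orbit that keeps it away from the zero section. If there is none, Farkas' lemma
  gives \<open>u\<close> orthogonal to \<open>V\<close> with \<open>u\<^sub>i \<ge> 0\<close> where \<open>x\<^sub>i \<noteq> 0\<close> and
  \<open>u \<bullet> \<alpha> > 0\<close>. As an algebraic subgroup is the common kernel of its trivial characters,
  the points \<open>(exp (- k u\<^sub>i))\<^sub>i\<close> lie in \<open>G\<close>, and they move \<open>(x, 1)\<close> towards the
  zero section.\<close>

section \<open>Characters of the torus\<close>

lemma carrier_torus: "carrier torus = {z. \<forall>i. z $ i \<noteq> 0}"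
  and mult_torus: "x \<otimes>\<^bsub>torus\<^esub> y = x * y"
  and one_torus: "\<one>\<^bsub>torus\<^esub> = 1"
  by (simp_all add: torus_def)

lemma group_torus: "group (torus :: (complex ^ 'n) monoid)"
proof (rule groupI)
  fix z :: "complex ^ 'n" assume "z \<in> carrier torus"
  then show "\<exists>y\<in>carrier torus. y \<otimes>\<^bsub>torus\<^esub> z = \<one>\<^bsub>torus\<^esub>"
    by (intro bexI[of _ "\<chi> i. inverse (z $ i)"]) (auto simp: torus_def vec_eq_iff)
qed (auto simp: torus_def mult.assoc)

lemma laurent_monom_mult: "laurent_monom m (y * z) = laurent_monom m y * laurent_monom m z"
  by (simp add: laurent_monom_def power_int_mult_distrib prod.distrib)

lemma laurent_monom_one: "laurent_monom m 1 = 1"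
  by (simp add: laurent_monom_def)

lemma laurent_monom_nonzero: "z \<in> carrier torus \<Longrightarrow> laurent_monom m z \<noteq> 0"
  by (simp add: laurent_monom_def carrier_torus)

lemma laurent_monom_diff:
  "z \<in> carrier torus \<Longrightarrow> laurent_monom (m - k) z = laurent_monom m z / laurent_monom k z"
  by (simp add: laurent_monom_def carrier_torus power_int_diff prod_dividef)

text \<open>The character lattice of the quotient torus: exponents of the characters that descend to
  it.\<close>

definition char_lattice :: "(complex ^ 'n) set \<Rightarrow> (int ^ 'n) set" where
  "char_lattice G = {m. \<forall>z\<in>G. laurent_monom m z = 1}"

text \<open>Dedekind's independence argument: if two of the characters differ at some \<open>g \<in> G\<close>,
  then \<open>f (g z)\<close> minus either of the two multiples of \<open>f z\<close> has fewer terms.\<close>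

lemma laurent_poly_vanishes:
  fixes G :: "(complex ^ 'n) set"
  assumes G: "subgroup G torus" and "finite M"
    and "\<forall>z\<in>G. (\<Sum>m\<in>M. c m * laurent_monom m z) = 0"
    and w: "w \<in> carrier torus" "\<forall>m\<in>char_lattice G. laurent_monom m w = 1"
  shows "(\<Sum>m\<in>M. c m * laurent_monom m w) = 0"
  using assms(2,3)
proof (induction "card M" arbitrary: M c rule: less_induct)
  case less
  have one: "1 \<in> G"
    using subgroup.one_closed[OF G] by (simp add: one_torus)
  show ?case
  proof (cases "\<exists>a\<in>M. \<exists>b\<in>M. \<exists>g\<in>G. laurent_monom a g \<noteq> laurent_monom b g")
    case True
    then obtain a b g where ab: "a \<in> M" "b \<in> M" "g \<in> G"
      and ne: "laurent_monom a g \<noteq> laurent_monom b g"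
      by blast
    have red: "(\<Sum>m\<in>M. c m * (laurent_monom m g - laurent_monom k g) * laurent_monom m w) = 0"
      if k: "k \<in> M" for k
    proof -
      let ?d = "\<lambda>m. c m * (laurent_monom m g - laurent_monom k g)"
      have drop: "(\<Sum>m\<in>M - {k}. ?d m * laurent_monom m z) = (\<Sum>m\<in>M. ?d m * laurent_monom m z)" for z
        using less.prems(1) k by (simp add: sum.remove)
      have "(\<Sum>m\<in>M - {k}. ?d m * laurent_monom m z) = 0" if z: "z \<in> G" for z
      proof -
        have "g * z \<in> G"
          using subgroup.m_closed[OF G ab(3) z] by (simp add: mult_torus)
        then have "(\<Sum>m\<in>M. c m * laurent_monom m (g * z)) -
            laurent_monom k g * (\<Sum>m\<in>M. c m * laurent_monom m z) = 0"
          using less.prems(2) z by simp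
        then show ?thesis
          unfolding drop
          by (simp add: laurent_monom_mult sum_distrib_left sum_subtractf[symmetric] algebra_simps)
      qed
      moreover have "card (M - {k}) < card M"
        using less.prems(1) k by (meson card_Diff1_less)
      ultimately have "(\<Sum>m\<in>M - {k}. ?d m * laurent_monom m w) = 0"
        using less.hyps[of "M - {k}" ?d] less.prems(1) by simp
      then show ?thesis
        by (simp add: drop)
    qed
    \<comment> \<open>Subtracting the relations for \<open>k = a\<close> and \<open>k = b\<close>
      recovers the full sum times a nonzero factor.\<close>
    have "(laurent_monom b g - laurent_monom a g) * (\<Sum>m\<in>M. c m * laurent_monom m w) =
        (\<Sum>m\<in>M. c m * (laurent_monom m g - laurent_monom a g) * laurent_monom m w) -
        (\<Sum>m\<in>M. c m * (laurent_monom m g - laurent_monom b g) * laurent_monom m w)"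
      by (simp add: sum_distrib_left sum_subtractf[symmetric] algebra_simps)
    also have "\<dots> = 0"
      by (simp add: red ab)
    finally show ?thesis
      using ne by simp
  next
    case False
    show ?thesis
    proof (cases "M = {}")
      case True
      then show ?thesis by simp
    next
      case nonempty: False
      then obtain a where a: "a \<in> M"
        by blast
      \<comment> \<open>All characters in \<open>M\<close> agree on \<open>G\<close>, so their
        quotients lie in \<open>char_lattice G\<close> and they agree at \<open>w\<close> too; the
        sum at \<open>w\<close> is then a multiple of its value at 1.\<close>
      have "laurent_monom m w = laurent_monom a w" if "m \<in> M" for m
      proof -
        have "laurent_monom (m - a) z = 1" if z: "z \<in> G" for z
        proof -
          have "z \<in> carrier torus"
            using subgroup.subset[OF G] z by blast
          moreover have "laurent_monom m z = laurent_monom a z"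
            using False \<open>m \<in> M\<close> a z by blast
          ultimately show ?thesis
            by (simp add: laurent_monom_diff laurent_monom_nonzero)
        qed
        then have "m - a \<in> char_lattice G"
          by (simp add: char_lattice_def)
        then show ?thesis
          using w laurent_monom_diff[OF w(1), of m a] laurent_monom_nonzero[OF w(1), of a] by simp
      qed
      then have "(\<Sum>m\<in>M. c m * laurent_monom m w) = (\<Sum>m\<in>M. c m) * laurent_monom a w"
        by (simp add: sum_distrib_right)
      moreover have "(\<Sum>m\<in>M. c m) = 0"
        using bspec[OF less.prems(2) one] by (simp add: laurent_monom_one)
      ultimately show ?thesis
        by simp
    qed
  qed
qed

text \<open>Each equation defining \<open>G\<close> is a Laurent polynomial vanishing on
  \<open>G\<close>, hence at \<open>w\<close> by Dedekind's argument.\<close>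

lemma algebraic_subgroup_memI:
  assumes "algebraic_subgroup G" "w \<in> carrier torus"
    and "\<And>m. m \<in> char_lattice G \<Longrightarrow> laurent_monom m w = 1"
  shows "w \<in> G"
proof -
  obtain S where S: "S \<subseteq> regular_funs" "G = {z \<in> carrier torus. \<forall>f\<in>S. f z = 0}"
    and G: "subgroup G torus"
    using assms(1) by (auto simp: algebraic_subgroup_def)
  have "f w = 0" if "f \<in> S" for f
  proof -
    have "f \<in> regular_funs"
      using S(1) that ..
    then obtain M c where f: "finite M" "f = (\<lambda>z. \<Sum>m\<in>M. c m * laurent_monom m z)"
      unfolding regular_funs_def by blast
    have "\<forall>z\<in>G. f z = 0"
      using S(2) that by blast
    then show ?thesis
      unfolding f(2) using assms(3) by (intro laurent_poly_vanishes[OF G f(1) _ assms(2)]) simp_all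
  qed
  then show ?thesis
    using S(2) assms(2) by blast
qed


section \<open>The dual lattice as a lattice of characters\<close>

text \<open>The differential of the character \<open>m\<close> at the identity, in the normalization
  of \<open>torus_exp\<close>.\<close>

definition char_diff :: "int ^ 'n \<Rightarrow> complex ^ 'n \<Rightarrow> complex" where
  "char_diff m \<xi> = (\<Sum>i\<in>UNIV. of_int (m $ i) * \<xi> $ i)"

lemma char_diff_add: "char_diff m (\<xi> + \<eta>) = char_diff m \<xi> + char_diff m \<eta>"
  by (simp add: char_diff_def sum.distrib distrib_left)

lemma char_diff_scale: "char_diff m (s *s \<xi>) = s * char_diff m \<xi>"
  by (simp add: char_diff_def sum_distrib_left algebra_simps)

lemma char_diff_axis: "char_diff m (axis i 1) = of_int (m $ i)"
  by (simp add: char_diff_def axis_def if_distrib cong: if_cong)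

section \<open>The exponential map of the torus\<close>

lemma exp_2pi_i_eq_1_iff: "exp (2 * of_real pi * \<i> * w) = 1 \<longleftrightarrow> w \<in> \<int>"
proof -
  have "exp (2 * of_real pi * \<i> * w) = 1 \<longleftrightarrow> (\<exists>n::int. 2 * of_real pi * \<i> * w = of_int (2 * n) * of_real pi * \<i>)"
    by (subst exp_eq_1) (auto simp: complex_eq_iff)
  also have "\<dots> \<longleftrightarrow> (\<exists>n::int. w = of_int n)"
    by (intro ex_cong1) auto
  finally show ?thesis
    by (auto simp: Ints_def)
qed

lemma torus_exp_carrier: "torus_exp \<xi> \<in> carrier torus"
  by (simp add: torus_exp_def carrier_torus)

lemma torus_exp_zero: "torus_exp 0 = 1"
  by (simp add: torus_exp_def vec_eq_iff)

lemma torus_exp_add: "torus_exp (\<xi> + \<eta>) = torus_exp \<xi> * torus_exp \<eta>"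
  by (simp add: torus_exp_def vec_eq_iff exp_add distrib_left)

lemma torus_exp_axis: "torus_exp (axis i 1) = 1"
proof -
  have "exp (2 * of_real pi * \<i>) = 1"
    using exp_2pi_i_eq_1_iff[of 1] by simp
  then show ?thesis
    by (simp add: torus_exp_def vec_eq_iff axis_def)
qed

lemma torus_exp_surj:
  assumes "z \<in> carrier torus"
  obtains \<xi> where "z = torus_exp \<xi>"
proof
  show "z = torus_exp (\<chi> i. Ln (z $ i) / (2 * of_real pi * \<i>))"
    using assms by (simp add: torus_exp_def vec_eq_iff carrier_torus)
qed

lemma laurent_monom_torus_exp:
  "laurent_monom m (torus_exp \<xi>) = exp (2 * of_real pi * \<i> * char_diff m \<xi>)"
  by (simp add: laurent_monom_def torus_exp_def char_diff_def exp_sum sum_distrib_left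
      exp_power_int algebra_simps)

text \<open>The character is trivial along the whole complex line through \<open>\<eta>\<close>, so
  every complex multiple of its differential there is an integer.\<close>

lemma char_diff_lie_alg:
  assumes "m \<in> char_lattice G" "\<eta> \<in> lie_alg G"
  shows "char_diff m \<eta> = 0"
proof -
  have "s * char_diff m \<eta> \<in> \<int>" for s
    using assms laurent_monom_torus_exp[of m "s *s \<eta>"]
    by (simp add: char_lattice_def lie_alg_def char_diff_scale exp_2pi_i_eq_1_iff)
  \<comment> \<open>A nonzero value would make 1/2 an integer.\<close>
  from this[of "1 / (2 * char_diff m \<eta>)"] show ?thesis
    by (cases "char_diff m \<eta> = 0") auto
qed

section \<open>The lattice of the quotient torus and its dual\<close>

context
  fixes G :: "(complex ^ 'n) set"
  assumes G: "subgroup G torus"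
begin

lemma one_mem: "1 \<in> G"
  using subgroup.one_closed[OF G] by (simp add: one_torus)

lemma mult_mem: "y \<in> G \<Longrightarrow> z \<in> G \<Longrightarrow> y * z \<in> G"
  using subgroup.m_closed[OF G] by (simp add: mult_torus)

lemma zero_mem_lie_alg: "0 \<in> lie_alg G"
  by (simp add: lie_alg_def one_mem torus_exp_zero)

text \<open>\<open>torus_exp\<close> maps \<open>lie_alg G\<close> into \<open>G\<close>, so the
  union defining \<open>quot_exp\<close> is a single coset of \<open>G\<close>.\<close>

lemma quot_proj_mem_lattice_iff: "quot_proj G \<xi> \<in> quot_lattice G \<longleftrightarrow> torus_exp \<xi> \<in> G"
proof -
  have eq: "quot_exp G (quot_proj G \<xi>) = {g * (torus_exp \<xi> * torus_exp \<eta>) |g \<eta>. g \<in> G \<and> \<eta> \<in> lie_alg G}"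
    by (auto simp: quot_exp_def quot_proj_def r_coset_def mult_torus torus_exp_add)
  have "quot_exp G (quot_proj G \<xi>) = G \<longleftrightarrow> torus_exp \<xi> \<in> G"
  proof
    assume "quot_exp G (quot_proj G \<xi>) = G"
    moreover have "torus_exp \<xi> \<in> quot_exp G (quot_proj G \<xi>)"
      unfolding eq using one_mem zero_mem_lie_alg
      by (intro CollectI exI[of _ 1] exI[of _ 0]) (simp add: torus_exp_zero)
    ultimately show "torus_exp \<xi> \<in> G"
      by simp
  next
    assume \<xi>: "torus_exp \<xi> \<in> G"
    have "torus_exp \<eta> \<in> G" if "\<eta> \<in> lie_alg G" for \<eta>
      using that by (auto simp: lie_alg_def dest: spec[of _ 1])
    then have "quot_exp G (quot_proj G \<xi>) \<subseteq> G"
      unfolding eq using \<xi> by (auto intro!: mult_mem)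
    moreover have "g \<in> quot_exp G (quot_proj G \<xi>)" if "g \<in> G" for g
    proof -
      have inv: "torus_exp (- \<xi>) * torus_exp \<xi> = 1"
        using torus_exp_add[of "- \<xi>" \<xi>] by (simp add: torus_exp_zero)
      have "inv\<^bsub>torus\<^esub> torus_exp \<xi> \<in> G"
        using subgroup.m_inv_closed[OF G \<xi>] .
      moreover have "inv\<^bsub>torus\<^esub> torus_exp \<xi> = torus_exp (- \<xi>)"
        using inv by (intro group.inv_equality[OF group_torus])
          (simp_all add: torus_exp_carrier mult_torus one_torus)
      ultimately have "g * torus_exp (- \<xi>) \<in> G"
        using that mult_mem by simp
      moreover have "g = g * torus_exp (- \<xi>) * (torus_exp \<xi> * torus_exp 0)"
        by (simp add: torus_exp_zero mult.assoc inv)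
      ultimately show ?thesis
        unfolding eq using zero_mem_lie_alg by blast
    qed
    ultimately show "quot_exp G (quot_proj G \<xi>) = G"
      by blast
  qed
  then show ?thesis
    by (simp add: quot_lattice_def quot_lie_def FactGroup_def)
qed

text \<open>Coordinate vectors exponentiate to 1, so their images lie in the lattice and
  \<open>p\<close> is integral on them. With these integers as exponent \<open>m\<close>, the
  pullback of \<open>p\<close> is the differential of a character, and integrality on the lattice
  makes that character trivial on \<open>G\<close>.\<close>

lemma dual_lattice_char:
  assumes "p \<in> dual_lattice G"
  obtains m where "m \<in> char_lattice G" "\<And>i. p (coord_image G i) = of_int (m $ i)"
proof -
  have "\<exists>k::int. p (coord_image G i) = of_int k" for i
    using assms quot_proj_mem_lattice_iff[of "axis i 1"]
    by (auto simp: coord_image_def dual_lattice_def torus_exp_axis one_mem elim!: Ints_cases)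
  then obtain k :: "'n \<Rightarrow> int" where k: "\<And>i. p (coord_image G i) = of_int (k i)"
    by metis
  define m :: "int ^ 'n" where "m = (\<chi> i. k i)"
  have lin: "Vector_Spaces.linear (*s) (*) (\<lambda>\<xi>. p (quot_proj G \<xi>))"
    using assms by (simp add: dual_lattice_def dual_space_def)
  interpret p: Vector_Spaces.linear "(*s)" "(*)" "\<lambda>\<xi>. p (quot_proj G \<xi>)"
    by (rule lin)
  have p_eq: "p (quot_proj G \<xi>) = char_diff m \<xi>" for \<xi>
  proof -
    have "p (quot_proj G \<xi>) = p (quot_proj G (\<Sum>i\<in>UNIV. \<xi> $ i *s axis i 1))"
      by (simp add: basis_expansion)
    also have "\<dots> = char_diff m \<xi>"
      by (simp add: p.sum p.scale k[unfolded coord_image_def] char_diff_def m_def mult.commute)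
    finally show ?thesis .
  qed
  have "laurent_monom m z = 1" if z: "z \<in> G" for z
  proof -
    obtain \<xi> where \<xi>: "z = torus_exp \<xi>"
      using z subgroup.subset[OF G] torus_exp_surj by blast
    then have "char_diff m \<xi> \<in> \<int>"
      using assms z quot_proj_mem_lattice_iff[of \<xi>] by (simp add: dual_lattice_def flip: p_eq)
    then show ?thesis
      by (simp add: \<xi> laurent_monom_torus_exp exp_2pi_i_eq_1_iff)
  qed
  then have "m \<in> char_lattice G"
    by (simp add: char_lattice_def)
  then show ?thesis
    using that k by (simp add: m_def)
qed

text \<open>The differential of \<open>m\<close> vanishes on \<open>lie_alg G\<close>, so it
  descends to the quotient.\<close>

lemma char_dual_lattice:
  assumes m: "m \<in> char_lattice G"
  obtains p where "p \<in> dual_lattice G" "\<And>i. p (coord_image G i) = of_int (m $ i)"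
proof -
  \<comment> \<open>Any representative gives the same value; 0 off the quotient is what
    \<open>dual_space\<close> demands.\<close>
  define p where "p v = (if v \<in> quot_lie G then char_diff m (SOME \<xi>. v = quot_proj G \<xi>) else 0)" for v
  have p_eq: "p (quot_proj G \<xi>) = char_diff m \<xi>" for \<xi>
  proof -
    define \<zeta> where "\<zeta> = (SOME \<zeta>. quot_proj G \<xi> = quot_proj G \<zeta>)"
    have "quot_proj G \<xi> = quot_proj G \<zeta>"
      unfolding \<zeta>_def by (rule someI_ex) blast
    moreover have "\<xi> \<in> quot_proj G \<xi>"
      using zero_mem_lie_alg by (force simp: quot_proj_def)
    ultimately obtain \<eta> where "\<eta> \<in> lie_alg G" "\<xi> = \<zeta> + \<eta>"
      by (auto simp: quot_proj_def)
    then have "char_diff m \<xi> = char_diff m \<zeta>"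
      using char_diff_lie_alg[OF m] by (simp add: char_diff_add)
    then show ?thesis
      by (simp add: p_def quot_lie_def \<zeta>_def)
  qed
  have "vector_space ((*) :: complex \<Rightarrow> _)"
    by unfold_locales (simp_all add: algebra_simps)
  then have "Vector_Spaces.linear (*s) (*) (\<lambda>\<xi>. p (quot_proj G \<xi>))"
    unfolding Vector_Spaces.linear_def p_eq module_hom_def module_hom_axioms_def
    by (simp add: vec.vector_space_axioms vec.module_axioms vector_space_def module_def
        char_diff_add char_diff_scale)
  moreover have "p v \<in> \<int>" if v: "v \<in> quot_lattice G" for v
  proof -
    obtain \<xi> where \<xi>: "v = quot_proj G \<xi>"
      using v by (auto simp: quot_lattice_def quot_lie_def)
    then have "torus_exp \<xi> \<in> G"
      using v quot_proj_mem_lattice_iff by simp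
    then have "laurent_monom m (torus_exp \<xi>) = 1"
      using m by (simp add: char_lattice_def)
    then show ?thesis
      by (simp add: \<xi> p_eq laurent_monom_torus_exp exp_2pi_i_eq_1_iff)
  qed
  ultimately have "p \<in> dual_lattice G"
    by (simp add: dual_lattice_def dual_space_def p_def)
  then show ?thesis
    using that by (simp add: coord_image_def p_eq char_diff_axis)
qed

end

section \<open>The real span of the character lattice\<close>

definition real_vec :: "int ^ 'n \<Rightarrow> real ^ 'n" where
  "real_vec m = (\<chi> i. of_int (m $ i))"

lemma real_vec_nth [simp]: "real_vec m $ i = of_int (m $ i)"
  by (simp add: real_vec_def)

lemma dual_real_span:
  assumes G: "subgroup G torus" and p: "p \<in> dual_real G"
  shows "(\<chi> i. Re (p (coord_image G i))) \<in> span (real_vec ` char_lattice G)"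
proof -
  obtain Q r where Q: "Q \<subseteq> dual_lattice G" "p = (\<lambda>v. \<Sum>q\<in>Q. complex_of_real (r q) * q v)"
    using p by (auto simp: dual_real_def)
  have "\<exists>m\<in>char_lattice G. \<forall>i. q (coord_image G i) = of_int (m $ i)" if "q \<in> Q" for q
    using dual_lattice_char[OF G] Q(1) that by (metis subsetD)
  then obtain f where f: "\<And>q. q \<in> Q \<Longrightarrow> f q \<in> char_lattice G"
    "\<And>q i. q \<in> Q \<Longrightarrow> q (coord_image G i) = of_int (f q $ i)"
    by metis
  have "(\<chi> i. Re (p (coord_image G i))) = (\<Sum>q\<in>Q. r q *\<^sub>R real_vec (f q))"
    by (simp add: vec_eq_iff Q(2) f(2))
  then show ?thesis
    using f(1) by (simp add: span_sum span_scale span_base)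
qed

lemma span_dual_real:
  assumes G: "subgroup G torus" and v: "v \<in> span (real_vec ` char_lattice G)"
  obtains p where "p \<in> dual_real G" "\<And>i. p (coord_image G i) = of_real (v $ i)"
proof -
  obtain t r where t: "finite t" "t \<subseteq> real_vec ` char_lattice G" "v = (\<Sum>a\<in>t. r a *\<^sub>R a)"
    using v by (auto simp: span_explicit)
  have "\<exists>q\<in>dual_lattice G. \<forall>i. q (coord_image G i) = of_real (a $ i)" if a: "a \<in> t" for a
  proof -
    obtain m where "m \<in> char_lattice G" "a = real_vec m"
      using t(2) a by blast
    then show ?thesis
      using char_dual_lattice[OF G, of m] by (metis of_real_of_int_eq real_vec_nth)
  qed
  then obtain f where f: "\<And>a. a \<in> t \<Longrightarrow> f a \<in> dual_lattice G"
    "\<And>a i. a \<in> t \<Longrightarrow> f a (coord_image G i) = of_real (a $ i)"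
    by metis
  \<comment> \<open>\<open>dual_real\<close> indexes combinations by functionals, so the
    coefficients on \<open>t\<close> are transported along \<open>f\<close>, which must be
    injective.\<close>
  have inj: "inj_on f t"
  proof (rule inj_onI)
    fix a b assume ab: "a \<in> t" "b \<in> t" "f a = f b"
    then have "complex_of_real (a $ i) = of_real (b $ i)" for i
      using f(2) by metis
    then show "a = b"
      by (simp add: vec_eq_iff)
  qed
  define p where "p = (\<lambda>v. \<Sum>q\<in>f ` t. complex_of_real (r (inv_into t f q)) * q v)"
  have "p \<in> dual_real G"
    unfolding dual_real_def p_def using t(1) f(1)
    by (intro CollectI exI[of _ "f ` t"] exI[of _ "\<lambda>q. r (inv_into t f q)"]) auto
  moreover have "p (coord_image G i) = of_real (v $ i)" for i
    by (simp add: p_def sum.reindex[OF inj] inv_into_f_f[OF inj] f(2) t(3))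
  ultimately show ?thesis
    using that by blast
qed


section \<open>The numerical criterion\<close>

lemma ln_norm_laurent_monom:
  assumes "z \<in> carrier torus"
  shows "ln (norm (laurent_monom m z)) = (\<Sum>i\<in>UNIV. of_int (m $ i) * ln (norm (z $ i)))"
proof -
  have ln_powi: "ln (r powi k) = of_int k * ln r" if "r > 0" for r :: real and k
    using that powr_real_of_int'[of r k] ln_powr[of r "of_int k"] by simp
  have "ln (norm (laurent_monom m z)) = ln (\<Prod>i\<in>UNIV. norm (z $ i) powi (m $ i))"
    by (simp add: laurent_monom_def norm_power_int flip: prod_norm)
  also have "\<dots> = (\<Sum>i\<in>UNIV. of_int (m $ i) * ln (norm (z $ i)))"
    using assms by (subst ln_prod) (auto simp: carrier_torus ln_powi)
  finally show ?thesis .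
qed

text \<open>Characters trivial on \<open>G\<close> have modulus 1 there, so the vector of logarithms
  is orthogonal to their exponents.\<close>

lemma ln_norm_orthogonal:
  assumes G: "subgroup G torus" and z: "z \<in> G" and v: "v \<in> span (real_vec ` char_lattice G)"
  shows "(\<Sum>i\<in>UNIV. v $ i * ln (norm (z $ i))) = 0"
proof -
  let ?w = "\<chi> i. ln (norm (z $ i)) :: real ^ 'a"
  have zc: "z \<in> carrier torus"
    using subgroup.subset[OF G] z by blast
  have "orthogonal ?w (real_vec m)" if "m \<in> char_lattice G" for m
  proof -
    have "ln (norm (laurent_monom m z)) = 0"
      using that z by (simp add: char_lattice_def)
    then show ?thesis
      by (simp add: orthogonal_def inner_vec_def mult.commute ln_norm_laurent_monom[OF zc])
  qed
  then have "orthogonal ?w v"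
    using v by (auto intro: orthogonal_to_span)
  then show ?thesis
    by (simp add: orthogonal_def inner_vec_def mult.commute)
qed

text \<open>On the orbit of \<open>(x, l)\<close> the invariant \<open>\<bar>l\<bar> \<cdot> \<Prod>\<bar>x\<^sub>i\<bar> powr (v\<^sub>i - \<alpha>\<^sub>i)\<close>, with the product over
  \<open>x\<^sub>i \<noteq> 0\<close>, is constant; its exponents are nonnegative, so \<open>\<bar>l\<bar>\<close> stays away
  from \<open>0\<close> as long as the base point stays bounded.\<close>

lemma semistable_if_point:
  fixes G :: "(complex ^ 'n) set"
  assumes G: "subgroup G torus" and v: "v \<in> span (real_vec ` char_lattice G)"
    and ge: "\<And>i. v $ i \<ge> of_int (\<alpha> $ i)"
    and eq: "\<And>i. x $ i = 0 \<Longrightarrow> v $ i = of_int (\<alpha> $ i)"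
  shows "semistable G \<alpha> x"
  unfolding semistable_def
proof (intro allI impI)
  fix l :: complex assume l: "l \<noteq> 0"
  have False if y: "(y, 0) \<in> closure ((\<lambda>z. lin_act \<alpha> z (x, l)) ` G)" for y
  proof -
    \<comment> \<open>\<open>B\<close> bounds the base of every orbit point within distance 1 of
      \<open>y\<close>; \<open>C\<close> is the resulting lower bound for the logarithm of the fibre
      modulus, so no such point is closer than \<open>exp C\<close>.\<close>
    define B where "B = norm y + 1"
    define C where "C = ln (norm l) - (\<Sum>i\<in>UNIV. (v $ i - of_int (\<alpha> $ i)) * (ln B - ln (norm (x $ i))))"
    obtain z where z: "z \<in> G" and d: "dist (lin_act \<alpha> z (x, l)) (y, 0) < min 1 (exp C)"
      using y by (auto simp: closure_approachable dest!: spec[of _ "min 1 (exp C)"])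
    have zc: "z \<in> carrier torus"
      using subgroup.subset[OF G] z by blast
    have "dist (z * x) y < 1"
      using d dist_fst_le[of "lin_act \<alpha> z (x, l)" "(y, 0)"] by (simp add: lin_act_def)
    then have "norm (z * x) < B"
      using norm_triangle_ineq2[of "z * x" y] by (simp add: B_def dist_norm)
    then have bound: "norm (z $ i) * norm (x $ i) < B" for i
      using Finite_Cartesian_Product.norm_nth_le[of "z * x" i]
      by (simp add: norm_mult)
    have small: "norm (laurent_monom \<alpha> z * l) < exp C"
      using d dist_snd_le[of "lin_act \<alpha> z (x, l)" "(y, 0)"] by (simp add: lin_act_def)
    \<comment> \<open>Where \<open>x $ i = 0\<close>, the factor
      \<open>v $ i - of_int (\<alpha> $ i)\<close> is 0, so the convention for \<open>ln 0\<close>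
      does no harm.\<close>
    have term_le: "(v $ i - of_int (\<alpha> $ i)) * ln (norm (z $ i)) \<le>
        (v $ i - of_int (\<alpha> $ i)) * (ln B - ln (norm (x $ i)))" for i
    proof (cases "x $ i = 0")
      case True
      then show ?thesis by (simp add: eq)
    next
      case False
      have zi: "z $ i \<noteq> 0"
        using zc by (simp add: carrier_torus)
      have "ln (norm (z $ i)) + ln (norm (x $ i)) = ln (norm (z $ i) * norm (x $ i))"
        using zi False by (simp add: ln_mult)
      also have "\<dots> \<le> ln B"
        using bound[of i] zi False by (intro ln_mono) auto
      finally show ?thesis
        using ge[of i] by (intro mult_left_mono) auto
    qed
    have "C \<le> ln (norm l) - (\<Sum>i\<in>UNIV. (v $ i - of_int (\<alpha> $ i)) * ln (norm (z $ i)))"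
      unfolding C_def by (intro diff_left_mono sum_mono term_le)
    also have "\<dots> = ln (norm l) + (\<Sum>i\<in>UNIV. of_int (\<alpha> $ i) * ln (norm (z $ i)))"
      using ln_norm_orthogonal[OF G z v] by (simp add: left_diff_distrib sum_subtractf)
    also have "\<dots> = ln (norm (laurent_monom \<alpha> z * l))"
      using l laurent_monom_nonzero[OF zc] by (simp add: norm_mult ln_mult ln_norm_laurent_monom[OF zc])
    finally have "exp C \<le> norm (laurent_monom \<alpha> z * l)"
      using l laurent_monom_nonzero[OF zc] by (simp add: ln_ge_iff)
    then show False
      using small by simp
  qed
  then show "closure ((\<lambda>z. lin_act \<alpha> z (x, l)) ` G) \<inter> UNIV \<times> {0} = {}"
    by auto
qed

text \<open>Solvability puts \<open>a\<close> in the cone \<open>V\<close> minus the nonnegative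
  orthant of the coordinates outside \<open>A\<close>; otherwise a hyperplane separates
  \<open>a\<close> from that cone, with normal \<open>u\<close>.\<close>

lemma farkas_subspace:
  fixes V :: "(real ^ 'n) set" and a :: "real ^ 'n"
  assumes V: "subspace V"
    and none: "\<not> (\<exists>v\<in>V. (\<forall>i. v $ i \<ge> a $ i) \<and> (\<forall>i\<in>A. v $ i = a $ i))"
  obtains u where "\<And>v. v \<in> V \<Longrightarrow> u \<bullet> v = 0" "\<And>i. i \<notin> A \<Longrightarrow> u $ i \<ge> 0" "u \<bullet> a > 0"
proof -
  obtain B where B: "B \<subseteq> V" "finite B" "V \<subseteq> span B"
    using basis_exists[of V] finiteI_independent by metis
  \<comment> \<open>\<open>B\<close> and its negatives generate \<open>V\<close>; the vectors
    \<open>- axis i 1\<close> lower the coordinates where slack is allowed.\<close>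
  define S where "S = B \<union> uminus ` B \<union> (\<lambda>i. - axis i 1) ` (- A)"
  define K where "K = convex_cone hull S"
  have cone: "convex_cone K"
    by (simp add: K_def convex_cone_convex_cone_hull)
  have SK: "s \<in> K" if "s \<in> S" for s
    using that by (simp add: K_def hull_inc)
  \<comment> \<open>A finitely generated cone is polyhedral, hence closed, as strict separation
    requires.\<close>
  have "polyhedron K"
    using B(2) by (simp add: K_def S_def polyhedron_convex_cone_hull)
  then have clK: "closed K"
    by (rule polyhedron_imp_closed)
  \<comment> \<open>The solvable right-hand sides form a convex cone containing \<open>S\<close>,
    hence \<open>K\<close>; so \<open>a\<close> is outside \<open>K\<close>.\<close>
  define D where "D = {w. \<exists>v\<in>V. (\<forall>i. v $ i \<ge> w $ i) \<and> (\<forall>i\<in>A. v $ i = w $ i)}"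
  have "convex_cone D"
    unfolding convex_cone_iff
  proof (intro conjI ballI allI impI)
    show "0 \<in> D"
      using subspace_0[OF V] by (auto simp: D_def intro!: bexI[of _ 0])
  next
    fix w w' assume "w \<in> D" "w' \<in> D"
    then obtain v v' where "v \<in> V" "\<forall>i. v $ i \<ge> w $ i" "\<forall>i\<in>A. v $ i = w $ i"
      "v' \<in> V" "\<forall>i. v' $ i \<ge> w' $ i" "\<forall>i\<in>A. v' $ i = w' $ i"
      by (auto simp: D_def)
    then show "w + w' \<in> D"
      unfolding D_def using subspace_add[OF V] by (auto intro!: bexI[of _ "v + v'"] add_mono)
  next
    fix w and c :: real assume "w \<in> D" "0 \<le> c"
    then obtain v where "v \<in> V" "\<forall>i. v $ i \<ge> w $ i" "\<forall>i\<in>A. v $ i = w $ i"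
      by (auto simp: D_def)
    then show "c *\<^sub>R w \<in> D"
      unfolding D_def using subspace_scale[OF V] \<open>0 \<le> c\<close>
      by (auto intro!: bexI[of _ "c *\<^sub>R v"] mult_left_mono)
  qed
  moreover have "S \<subseteq> D"
  proof
    fix s assume "s \<in> S"
    then consider "s \<in> V" | i where "i \<notin> A" "s = - axis i 1"
      using B(1) subspace_neg[OF V] by (auto simp: S_def)
    then show "s \<in> D"
    proof cases
      case 1
      then show ?thesis by (auto simp: D_def)
    next
      case 2
      then show ?thesis
        unfolding D_def using subspace_0[OF V] by (auto intro!: bexI[of _ 0] simp: axis_def)
    qed
  qed
  ultimately have "K \<subseteq> D"
    unfolding K_def by (intro hull_minimal) auto
  then have "a \<notin> K"
    using none unfolding D_def by blast
  then obtain u' b where u': "u' \<bullet> a < b" "\<forall>k\<in>K. b < u' \<bullet> k"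
    using separating_hyperplane_closed_point[of K a] cone clK by (auto simp: convex_cone_def)
  have zero: "0 \<in> K"
    using cone by (simp add: convex_cone_contains_0)
  \<comment> \<open>If \<open>u'\<close> were negative at \<open>k\<close>, a nonnegative multiple
    of \<open>k\<close> would have value exactly \<open>b\<close>, against the strict bound.\<close>
  have nonneg: "u' \<bullet> k \<ge> 0" if k: "k \<in> K" for k
  proof (rule ccontr)
    assume neg: "\<not> u' \<bullet> k \<ge> 0"
    have b: "b < 0"
      using u'(2) zero by force
    have "(b / (u' \<bullet> k)) *\<^sub>R k \<in> K"
      using cone k b neg by (intro convex_cone_scaleR) (auto simp: zero_le_divide_iff)
    then show False
      using u'(2) neg by force
  qed
  have "orthogonal u' s" if "s \<in> B" for s
    using nonneg[OF SK, of s] nonneg[OF SK, of "- s"] that by (auto simp: S_def orthogonal_def)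
  then have orth: "u' \<bullet> v = 0" if "v \<in> V" for v
    using orthogonal_to_span[of v B u'] B(3) that by (auto simp: orthogonal_def)
  \<comment> \<open>The sign flips: \<open>u'\<close> is nonnegative on \<open>K\<close> but
    negative at \<open>a\<close>, since \<open>b\<close> lies below its value at 0.\<close>
  show ?thesis
  proof
    show "- u' \<bullet> v = 0" if "v \<in> V" for v
      using orth[OF that] by simp
    show "(- u') $ i \<ge> 0" if "i \<notin> A" for i
      using nonneg[OF SK, of "- axis i 1"] that by (auto simp: S_def inner_axis)
    show "- u' \<bullet> a > 0"
      using u' zero by force
  qed
qed

text \<open>For real \<open>u\<close> the points \<open>z k\<close> need not lie on an algebraic
  one-parameter subgroup; they are in \<open>G\<close> because every character trivial on
  \<open>G\<close> is 1 at them.\<close>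

lemma not_semistable_if_direction:
  fixes u :: "real ^ 'n"
  assumes G: "algebraic_subgroup G"
    and orth: "\<And>m. m \<in> char_lattice G \<Longrightarrow> u \<bullet> real_vec m = 0"
    and nonneg: "\<And>i. x $ i \<noteq> 0 \<Longrightarrow> u $ i \<ge> 0"
    and pos: "u \<bullet> real_vec \<alpha> > 0"
  shows "\<not> semistable G \<alpha> x"
proof -
  define z :: "nat \<Rightarrow> complex ^ 'n" where "z k = (\<chi> i. of_real (exp (- real k * u $ i)))" for k
  have monom: "laurent_monom m (z k) = of_real (exp (- real k * (u \<bullet> real_vec m)))" for m k
  proof -
    have "laurent_monom m (z k) = of_real (\<Prod>i\<in>UNIV. exp (- real k * u $ i) powi (m $ i))"
      by (simp add: laurent_monom_def z_def)
    also have "(\<Prod>i\<in>UNIV. exp (- real k * u $ i) powi (m $ i)) = exp (- real k * (u \<bullet> real_vec m))"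
      by (simp add: exp_power_int inner_vec_def sum_distrib_left flip: exp_sum)
        (simp add: algebra_simps flip: sum_negf)
    finally show ?thesis .
  qed
  have zG: "z k \<in> G" for k
    proof (rule algebraic_subgroup_memI[OF G])
    show "z k \<in> carrier torus"
      by (simp add: carrier_torus z_def)
  qed (simp add: monom orth)
  have lim0: "(\<lambda>k. complex_of_real (exp (- real k * c))) \<longlonglongrightarrow> 0" if "c > 0" for c :: real
  proof -
    have "(\<lambda>k. complex_of_real (exp (- c)) ^ k) \<longlonglongrightarrow> 0"
      using that by (intro LIMSEQ_power_zero) simp
    moreover have "complex_of_real (exp (- real k * c)) = of_real (exp (- c)) ^ k" for k
      using exp_of_nat_mult[of k "- c"] by (simp flip: of_real_power)
    ultimately show ?thesis
      by simp
  qed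
  \<comment> \<open>Coordinates with \<open>u $ i > 0\<close> shrink to 0, those with
    \<open>u $ i = 0\<close> stay fixed, and where \<open>u $ i < 0\<close> already
    \<open>x $ i = 0\<close>.\<close>
  define y where "y = (\<chi> i. if u $ i = 0 then x $ i else 0)"
  have "(\<lambda>k. z k * x) \<longlonglongrightarrow> y"
  proof (rule vec_tendstoI)
    fix i
    consider "x $ i = 0" | "u $ i = 0" | "x $ i \<noteq> 0" "u $ i > 0"
      using nonneg[of i] by fastforce
    then show "(\<lambda>k. (z k * x) $ i) \<longlonglongrightarrow> y $ i"
    proof cases
      case 3
      then show ?thesis
        using tendsto_mult_right[OF lim0[of "u $ i"], of "x $ i"] by (simp add: z_def y_def)
    qed (simp_all add: z_def y_def)
  qed
  moreover have "(\<lambda>k. laurent_monom \<alpha> (z k) * 1) \<longlonglongrightarrow> 0"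
    using lim0[OF pos] by (simp add: monom)
  ultimately have "(\<lambda>k. lin_act \<alpha> (z k) (x, 1)) \<longlonglongrightarrow> (y, 0)"
    unfolding lin_act_def by (simp add: tendsto_Pair)
  then have "(y, 0) \<in> closure ((\<lambda>z. lin_act \<alpha> z (x, 1)) ` G)"
    unfolding closure_sequential using zG by (intro exI[of _ "\<lambda>k. lin_act \<alpha> (z k) (x, 1)"]) blast
  then show ?thesis
    unfolding semistable_def using zero_neq_one by (metis IntI SigmaI UNIV_I emptyE singletonI)
qed

theorem theorem2p3:
  fixes G :: "(complex ^ 'n) set" and \<alpha> :: "int ^ 'n" and x :: "complex ^ 'n"
  assumes "algebraic_subgroup G"
  shows "semistable G \<alpha> x \<longleftrightarrow>
           assoc_polyhedron G \<alpha> \<inter> (\<Inter>i\<in>{i. x $ i = 0}. poly_face G \<alpha> i) \<noteq> {}"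
proof -
  have G: "subgroup G torus"
    using assms by (simp add: algebraic_subgroup_def)
  let ?V = "span (real_vec ` char_lattice G)"
  show ?thesis
  proof
    assume ss: "semistable G \<alpha> x"
    \<comment> \<open>\<open>v\<close> lists the values on the \<open>coord_image G i\<close> of the
      point sought; if there is none, Farkas gives a destabilizing direction.\<close>
    have "\<exists>v\<in>?V. (\<forall>i. v $ i \<ge> real_vec \<alpha> $ i) \<and> (\<forall>i\<in>{i. x $ i = 0}. v $ i = real_vec \<alpha> $ i)"
    proof (rule ccontr)
      assume "\<not> ?thesis"
      then obtain u where "\<And>v. v \<in> ?V \<Longrightarrow> u \<bullet> v = 0" "\<And>i. x $ i \<noteq> 0 \<Longrightarrow> u $ i \<ge> 0"
        "u \<bullet> real_vec \<alpha> > 0"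
        using farkas_subspace[of ?V "real_vec \<alpha>" "{i. x $ i = 0}"] by auto
      then show False
        using not_semistable_if_direction[OF assms, of u x \<alpha>] ss by (simp add: span_base)
    qed
    then obtain v where v: "v \<in> ?V" "\<And>i. v $ i \<ge> of_int (\<alpha> $ i)"
      "\<And>i. x $ i = 0 \<Longrightarrow> v $ i = of_int (\<alpha> $ i)"
      by auto
    obtain p where "p \<in> dual_real G" "\<And>i. p (coord_image G i) = of_real (v $ i)"
      using span_dual_real[OF G v(1)] by blast
    then have "p \<in> assoc_polyhedron G \<alpha> \<inter> (\<Inter>i\<in>{i. x $ i = 0}. poly_face G \<alpha> i)"
      using v by (simp add: assoc_polyhedron_def poly_face_def)
    then show "assoc_polyhedron G \<alpha> \<inter> (\<Inter>i\<in>{i. x $ i = 0}. poly_face G \<alpha> i) \<noteq> {}"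
      by blast
  next
    assume "assoc_polyhedron G \<alpha> \<inter> (\<Inter>i\<in>{i. x $ i = 0}. poly_face G \<alpha> i) \<noteq> {}"
    then obtain p where p: "p \<in> dual_real G" "\<And>i. Re (p (coord_image G i)) \<ge> of_int (\<alpha> $ i)"
      "\<And>i. x $ i = 0 \<Longrightarrow> Re (p (coord_image G i)) = of_int (\<alpha> $ i)"
      by (auto simp: assoc_polyhedron_def poly_face_def)
    then show "semistable G \<alpha> x"
      using semistable_if_point[OF G dual_real_span[OF G p(1)]] by simp
  qed
qed

end
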